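(* For every odd prime $p$, the polynomial $$f(x) = x^{p-2} + x^{p-3} + \dots + x^3 + x^2 + 2x + 1, \quad\text{that is,}\quad f(x) = 1 + 2x + \sum_{k=2}^{p-2} x^k,$$ with coefficients in $\mathbb{Z}_p$, represents the transposition $(0\; 1)$ over $\mathbb{Z}_p$; that is, $$f(0)\equiv 1 \pmod p, \qquad f(1)\equiv 0 \pmod p, \qquad f(a)\equiv a \pmod p \ \text{ for all integers } a \text{ with } 2\le a\le p-1.$$
   Context: $\mathbb{Z}_p$ denotes the ring (field) $\mathbb{Z}/p\mathbb{Z}$ of integers modulo $p$. Given a ring $R$, a polynomial $P(x)\in R[x]$ represents a function $g\colon R\to R$ if $P(a)=g(a)$ for every $a\in R$. The transposition $(0\; 1)$ over $\mathbb{Z}_p$ is the permutation of $\mathbb{Z}_p$ that swaps $0$ and $1$ and fixes every other element. An empty sum is $0$, so for $p=3$ the polynomial is $f(x)=2x+1$. *)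

theory Defs
  imports
    "HOL-Number_Theory.Residues"
    "HOL-Combinatorics.Transposition"
    "HOL-Computational_Algebra.Polynomial"
begin

definition represents :: "('a, 'b) ring_scheme \<Rightarrow> (nat \<Rightarrow> 'a) \<Rightarrow> ('a \<Rightarrow> 'a) \<Rightarrow> bool" where
  "represents R P g \<longleftrightarrow>
     P \<in> carrier (UP R) \<and> g \<in> carrier R \<rightarrow> carrier R \<and>
     (\<forall>a\<in>carrier R. UnivPoly.eval R R id a P = g a)"

text \<open>The polynomial \<open>1 + 2x + x^2 + \<dots> + x^(p-2)\<close>; for \<open>p = 3\<close> the sum is empty.\<close>

definition swap_poly :: "('a, 'b) ring_scheme \<Rightarrow> nat \<Rightarrow> nat \<Rightarrow> 'a" where
  "swap_poly R p =
     up_ring.monom (UP R) \<one>\<^bsub>R\<^esub> 0 \<oplus>\<^bsub>UP R\<^esub>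
     up_ring.monom (UP R) (\<one>\<^bsub>R\<^esub> \<oplus>\<^bsub>R\<^esub> \<one>\<^bsub>R\<^esub>) 1 \<oplus>\<^bsub>UP R\<^esub>
     (\<Oplus>\<^bsub>UP R\<^esub> k\<in>{2..p-2}. up_ring.monom (UP R) \<one>\<^bsub>R\<^esub> k)"

text \<open>The same polynomial with integer coefficients, so that its values at integers can be
  compared modulo \<open>p\<close>.\<close>

definition int_swap_poly :: "nat \<Rightarrow> int poly" where
  "int_swap_poly p = [:1, 2:] + (\<Sum>k=2..p-2. Polynomial.monom 1 k)"

end

theory Submission
  imports Defs
begin

text \<open>
  Taking one \<open>x\<close> aside, the polynomial is \<open>f(x) = x + (1 + x + \<dots> + x^(p-2))\<close>, so it deviates
  from the identity exactly by the geometric sum \<open>g(x) = 1 + x + \<dots> + x^(p-2)\<close>. Since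
  \<open>(x - 1) g(x) = x^(p-1) - 1\<close>, Fermat's little theorem makes \<open>g\<close> vanish modulo \<open>p\<close> at every
  residue other than \<open>0\<close> and \<open>1\<close>. At the two exceptional points \<open>g(0) = 1\<close> and
  \<open>g(1) = p - 1\<close>, whence \<open>f(0) = 1\<close> and \<open>f(1) = p\<close>.

  This settles the congruences for the integer polynomial (\<open>cong_geometric_sum_prime\<close>,
  \<open>poly_int_swap_poly\<close>). Evaluation of the polynomial over the residue ring is then reduced to
  these congruences: evaluation is a ring homomorphism and so acts monomial by monomial, and
  reduction modulo \<open>p\<close> commutes with the sums and powers that result
  (\<open>eval_swap_poly_residue_ring\<close>).
\<close>

lemma poly_int_swap_poly:
  assumes "3 \<le> p"
  shows "poly (int_swap_poly p) a = a + (\<Sum>k<p-1. a ^ k)"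
proof -
  have "{..<p-1} = insert 0 (insert 1 {2..p-2})"
    using assms by auto
  then show ?thesis
    by (simp add: int_swap_poly_def poly_sum poly_monom algebra_simps)
qed

text \<open>
  The product \<open>(a - 1) (1 + a + \<dots> + a^(p-2))\<close> equals \<open>a^(p-1) - 1\<close>, which \<open>p\<close> divides by
  Fermat, and \<open>p\<close> is prime to the first factor.
\<close>

lemma cong_geometric_sum_prime:
  fixes a :: int
  assumes "prime p" and "\<not> int p dvd a" and "\<not> int p dvd a - 1"
  shows "[(\<Sum>k<p-1. a ^ k) = 0] (mod int p)"
proof -
  interpret residues_prime p "residue_ring (int p)"
    by unfold_locales (fact assms(1))
  have "coprime a (int p)"
    using assms(2) by (simp add: p_coprime_right_int)
  then have "[a ^ (p - 1) = 1] (mod int p)"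
    using euler_theorem by (simp add: totient_prime[OF assms(1)])
  then have "int p dvd a ^ (p - 1) - 1"
    by (simp add: cong_iff_dvd_diff)
  then have "int p dvd (a - 1) * (\<Sum>k<p-1. a ^ k)"
    by (simp add: power_diff_1_eq)
  then show ?thesis
    using assms by (simp add: prime_dvd_mult_iff cong_0_iff)
qed

lemma int_swap_poly_cong_transpose:
  assumes "prime p" and "odd p" and "0 \<le> a" and "a < int p"
  shows "[poly (int_swap_poly p) a = transpose 0 1 a] (mod int p)"
proof -
  have p: "3 \<le> p"
    using assms(1,2) prime_ge_2_nat[of p] by (cases "p = 2") auto
  consider "a = 0" | "a = 1" | "2 \<le> a"
    using assms(3) by linarith
  then show ?thesis
  proof cases
    case 1
    have "(\<Sum>k<p-1. (0::int) ^ k) = 1"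
      using p by (simp add: power_0_left)
    with 1 p show ?thesis
      by (simp add: poly_int_swap_poly)
  next
    case 2
    with p show ?thesis
      by (simp add: poly_int_swap_poly cong_0_iff of_nat_diff)
  next
    case 3
    then have "[(\<Sum>k<p-1. a ^ k) = 0] (mod int p)"
      using assms by (intro cong_geometric_sum_prime) (auto dest: zdvd_imp_le)
    then have "[a + (\<Sum>k<p-1. a ^ k) = a + 0] (mod int p)"
      by (intro cong_add cong_refl)
    with 3 p show ?thesis
      by (simp add: poly_int_swap_poly transpose_def)
  qed
qed

lemma (in cring) swap_poly_closed: "swap_poly R p \<in> carrier (UP R)"
proof -
  interpret UP_cring R "UP R"
    by unfold_locales
  show ?thesis
    by (auto simp: swap_poly_def)
qed

text \<open>Evaluation at \<open>a\<close> is a ring homomorphism, so it acts on each monomial separately.\<close>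

lemma (in cring) eval_swap_poly:
  assumes "a \<in> carrier R"
  shows "UnivPoly.eval R R id a (swap_poly R p) =
           \<one> \<oplus> (\<one> \<oplus> \<one>) \<otimes> a \<oplus> (\<Oplus>k\<in>{2..p-2}. a [^] k)"
proof -
  interpret U: UP_pre_univ_prop R R id "UP R"
    by unfold_locales simp
  interpret E: ring_hom_cring "UP R" R "UnivPoly.eval R R id a"
    by unfold_locales (rule U.eval_ring_hom[OF assms])
  have "UnivPoly.eval R R id a (\<Oplus>\<^bsub>UP R\<^esub> k\<in>{2..p-2}. up_ring.monom (UP R) \<one> k) =
        (\<Oplus>k\<in>{2..p-2}. a [^] k)"
    using assms by (simp add: U.eval_monom comp_def cong: finsum_cong)
  then show ?thesis
    using assms U.eval_monom[of \<one> a 0] U.eval_monom[of "\<one> \<oplus> \<one>" a 1]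
    by (simp add: swap_poly_def)
qed

text \<open>
  The bridge between the two polynomials: a sum of powers formed in the residue ring is the
  reduction of the integer sum of powers, whatever the modulus.
\<close>

lemma (in residues) eval_swap_poly_residue_ring:
  assumes "a \<in> carrier R"
  shows "UnivPoly.eval R R id a (swap_poly R p) = poly (int_swap_poly p) a mod m"
proof -
  have a: "a mod m = a"
    using assms by (simp add: res_carrier_eq)
  have "(\<Oplus>k\<in>{2..p-2}. a [^] k) = (\<Sum>k=2..p-2. a ^ k) mod m"
    using sum_cong[of "{2..p-2}" "\<lambda>k. a ^ k"] pow_cong[of a] a by simp
  then show ?thesis
    using assms
    by (simp add: eval_swap_poly res_add_eq res_mult_eq res_one_eq int_swap_poly_def
        poly_sum poly_monom mod_simps algebra_simps)
qed

theorem theorem1: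
  fixes p :: nat
  assumes "prime p" and "odd p"
  shows "represents (residue_ring (int p)) (swap_poly (residue_ring (int p)) p)
           (transpose \<zero>\<^bsub>residue_ring (int p)\<^esub> \<one>\<^bsub>residue_ring (int p)\<^esub>) \<and>
         [poly (int_swap_poly p) 0 = 1] (mod int p) \<and>
         [poly (int_swap_poly p) 1 = 0] (mod int p) \<and>
         (\<forall>a::int. 2 \<le> a \<and> a \<le> int p - 1 \<longrightarrow> [poly (int_swap_poly p) a = a] (mod int p))"
proof -
  interpret residues_prime p "residue_ring (int p)"
    by unfold_locales (fact assms(1))
  let ?R = "residue_ring (int p)"
  note f = int_swap_poly_cong_transpose[OF assms]
  have transpose_closed: "transpose 0 1 a \<in> carrier ?R" if "a \<in> carrier ?R" for a
    using that m_gt_one by (auto simp: res_carrier_eq transpose_def)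
  have "UnivPoly.eval ?R ?R id a (swap_poly ?R p) = transpose 0 1 a"
    if a: "a \<in> carrier ?R" for a
  proof -
    have "poly (int_swap_poly p) a mod int p = transpose 0 1 a mod int p"
      using f[of a] a by (simp add: res_carrier_eq cong_def)
    also have "\<dots> = transpose 0 1 a"
      using transpose_closed[OF a] by (simp add: res_carrier_eq)
    finally show ?thesis
      using a by (simp add: eval_swap_poly_residue_ring)
  qed
  then have "represents ?R (swap_poly ?R p) (transpose \<zero>\<^bsub>?R\<^esub> \<one>\<^bsub>?R\<^esub>)"
    using transpose_closed swap_poly_closed
    by (simp add: represents_def res_zero_eq res_one_eq)
  moreover have "[poly (int_swap_poly p) a = a] (mod int p)" if "2 \<le> a" "a \<le> int p - 1" for a
    using f[of a] that by (simp add: transpose_def)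
  ultimately show ?thesis
    using f[of 0] f[of 1] m_gt_one by simp
qed

end
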